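(* Let $(X,d)$ be a metric space, with $X$ nonempty. Define $p_d : X\times X\to[1,+\infty)$ by $p_d(x,y)=e^{d(x,y)}$. Then $(X,p_d)$ is a multiplicative metric space.
   Context: A multiplicative metric space is a pair $(X,p)$ where $X$ is a nonempty set and $p:X\times X\to[1,+\infty)$ is a function such that for all $x,y,z\in X$: (1) $p(x,y)\ge 1$, and $x=y$ if and only if $p(x,y)=1$; (2) $p(x,y)=p(y,x)$; (3) $p(x,z)\le p(x,y)\,p(y,z)$. *)

theory Defs
  imports "HOL-Analysis.Analysis"
begin

text \<open>The codomain \<open>[1, \<infinity>)\<close> of \<open>p\<close> is expressed by axiom \<open>one_le\<close>. All axioms are
  relativised to the carrier, so values of \<open>p\<close> outside \<open>X \<times> X\<close> are irrelevant.\<close>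

locale Multiplicative_metric_space =
  fixes X :: "'a set" and p :: "'a \<Rightarrow> 'a \<Rightarrow> real"
  assumes nonempty: "X \<noteq> {}"
    and one_le: "\<And>x y. \<lbrakk>x \<in> X; y \<in> X\<rbrakk> \<Longrightarrow> p x y \<ge> 1"
    and eq_iff: "\<And>x y. \<lbrakk>x \<in> X; y \<in> X\<rbrakk> \<Longrightarrow> x = y \<longleftrightarrow> p x y = 1"
    and commute: "\<And>x y. \<lbrakk>x \<in> X; y \<in> X\<rbrakk> \<Longrightarrow> p x y = p y x"
    and triangle: "\<And>x y z. \<lbrakk>x \<in> X; y \<in> X; z \<in> X\<rbrakk> \<Longrightarrow> p x z \<le> p x y * p y z"

definition exp_dist :: "('a \<Rightarrow> 'a \<Rightarrow> real) \<Rightarrow> 'a \<Rightarrow> 'a \<Rightarrow> real" where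
  "exp_dist d x y = exp (d x y)"

end

theory Submission
  imports Defs
begin

text \<open>The exponential is an increasing injective homomorphism from \<open>(\<real>, +, 0)\<close> to
  \<open>(\<real>\<^sub>>\<^sub>0, \<cdot>, 1)\<close>, so it carries each additive metric axiom to its multiplicative
  counterpart.\<close>

theorem theorem4:
  fixes X :: "'a set" and d :: "'a \<Rightarrow> 'a \<Rightarrow> real"
  assumes "Metric_space X d" and "X \<noteq> {}"
  shows "Multiplicative_metric_space X (exp_dist d)"
proof -
  interpret Metric_space X d by (fact assms(1))
  show ?thesis
  proof
    show "X \<noteq> {}" by (fact assms(2))
  next
    fix x y assume "x \<in> X" "y \<in> X"
    then show "exp_dist d x y \<ge> 1" and "x = y \<longleftrightarrow> exp_dist d x y = 1"
      by (simp_all add: exp_dist_def)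
    show "exp_dist d x y = exp_dist d y x"
      by (simp add: exp_dist_def commute)
  next
    fix x y z assume "x \<in> X" "y \<in> X" "z \<in> X"
    then show "exp_dist d x z \<le> exp_dist d x y * exp_dist d y z"
      by (simp add: exp_dist_def triangle flip: exp_add)
  qed
qed

end
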